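(* Suppose in addition that $\varphi$ is convex on $[0,\infty)$. Then the space $G_{\sigma}(\psi^* )$ consists exactly of the functions $f \in C^{\infty}(\mathbb{R})$ (complex-valued) such that for each $\varepsilon > 0$ and $n \in \mathbb{Z}_+$ there exists a number $C_{\varepsilon,n} > 0$ such that $$|f^{(n)}(x)| \le C_{\varepsilon,n}\, e^{-\varphi^*\left(\frac{|x|}{\sigma+\varepsilon}\right)}, \quad x \in \mathbb{R}.$$
   Context: $\mathbb{Z}_+ = \{0,1,2,\dots\}$, and $0^0 = 1$. Fix a real number $\sigma > 0$ and a nonnegative nondecreasing continuous function $\varphi$ on $[0,\infty)$ such that: (1) $\lim_{x\to+\infty} \varphi(x)/x = +\infty$; (2) for every $h > 1$ there exists $K_h > 0$ such that $2\varphi(x) \le \varphi(hx) + K_h$ for all $x \in [0,\infty)$; (3) the function $x \mapsto \varphi(e^x)$ is convex on $[0,\infty)$. For a continuous $g:[0,\infty)\to\mathbb{R}$ with $\lim_{x\to+\infty} g(x)/x = +\infty$, the Young conjugate is $g^*(x) = \sup_{y>0}(xy - g(y))$, $x \ge 0$. Thus $\varphi^*(x) = \sup_{y>0}(xy-\varphi(y))$ and, with $\psi(x) = \varphi(e^x)$, $\psi^*(x) = \sup_{y>0}(xy - \psi(y))$ for $x \ge 0$. For $\varepsilon > 0$ and $m \in \mathbb{Z}_+$, $G_{\varepsilon,m}(\psi^* )$ is the set of (complex-valued) $f \in C^m(\mathbb{R})$ with $$\|f\|_{\varepsilon,m} = \max_{0\le n\le m}\ \sup_{x\in\mathbb{R},\,k\in\mathbb{Z}_+}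 \frac{|x^k f^{(n)}(x)|}{k!\,(\sigma+\varepsilon)^k e^{-\psi^*(k)}} < \infty,$$ and $G_{\sigma}(\psi^* ) = \bigcap_{\varepsilon>0,\,m\in\mathbb{Z}_+} G_{\varepsilon,m}(\psi^* )$. *)

theory Defs
  imports "HOL-Analysis.Analysis"
begin

text \<open>The supremum is taken in the reals. If \<open>g\<close> is continuous on \<open>{0..}\<close> and
  \<open>g(y)/y \<rightarrow> \<infinity>\<close>, the set is bounded above, so this is a genuine supremum; for other \<open>g\<close>
  the value may be meaningless.\<close>

definition young_conj :: "(real \<Rightarrow> real) \<Rightarrow> real \<Rightarrow> real" where
  "young_conj g x = (SUP y\<in>{0<..}. x * y - g y)"

text \<open>Derivatives with respect to the real variable; meaningful only under \<open>Cm\<close> below.\<close>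

definition nderiv :: "nat \<Rightarrow> (real \<Rightarrow> complex) \<Rightarrow> real \<Rightarrow> complex" where
  "nderiv n f = ((\<lambda>g x. vector_derivative g (at x)) ^^ n) f"

definition Cm :: "nat \<Rightarrow> (real \<Rightarrow> complex) set" where
  "Cm m = {f. (\<forall>k<m. \<forall>x. nderiv k f differentiable (at x)) \<and> continuous_on UNIV (nderiv m f)}"

definition Cinf :: "(real \<Rightarrow> complex) set" where
  "Cinf = (\<Inter>m. Cm m)"

text \<open>The parameter \<open>\<Psi>\<close> stands for \<open>\<psi>\<^sup>*\<close>, the Young conjugate itself, not for \<open>\<psi>\<close>.\<close>

definition G_norm ::
  "real \<Rightarrow> (real \<Rightarrow> real) \<Rightarrow> real \<Rightarrow> nat \<Rightarrow> (real \<Rightarrow> complex) \<Rightarrow> ereal" where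
  "G_norm \<sigma> \<Psi> \<epsilon> m f =
     (MAX n\<in>{0..m}. SUP (x, k)\<in>(UNIV :: (real \<times> nat) set).
        ereal (cmod (of_real x ^ k * nderiv n f x) /
               (fact k * (\<sigma> + \<epsilon>) ^ k * exp (- \<Psi> (real k)))))"

definition G_space_eps :: "real \<Rightarrow> (real \<Rightarrow> real) \<Rightarrow> real \<Rightarrow> nat \<Rightarrow> (real \<Rightarrow> complex) set" where
  "G_space_eps \<sigma> \<Psi> \<epsilon> m = {f \<in> Cm m. G_norm \<sigma> \<Psi> \<epsilon> m f < \<infinity>}"

definition G_space :: "real \<Rightarrow> (real \<Rightarrow> real) \<Rightarrow> (real \<Rightarrow> complex) set" where
  "G_space \<sigma> \<Psi> = (\<Inter>\<epsilon>\<in>{0<..}. \<Inter>m. G_space_eps \<sigma> \<Psi> \<epsilon> m)"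

end

theory Submission
  imports Defs
begin

text \<open>Both descriptions of the space bound each derivative \<open>g = f\<^sup>(\<^sup>n\<^sup>)\<close> separately, so it suffices
  to compare, at a single point and with \<open>u = \<bar>x\<bar> / (\<sigma> + \<epsilon>)\<close>, the family of moment bounds
  \<open>u\<^sup>k \<bar>g(x)\<bar> \<le> C k! exp (- \<psi>\<^sup>*(k))\<close> with the single bound \<open>\<bar>g(x)\<bar> \<le> C exp (- \<phi>\<^sup>*(u))\<close>.
  The substitution \<open>t = exp y\<close> turns the supremum defining \<open>\<psi>\<^sup>*\<close> into the statement that
  \<open>exp (- \<psi>\<^sup>*(k))\<close> is the infimum of \<open>exp (\<phi>(t)) / t\<^sup>k\<close> over \<open>t > 1\<close>, while \<open>exp (- \<phi>\<^sup>*(u))\<close>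
  is the infimum of \<open>exp (\<phi>(t)) / exp (u t)\<close> over \<open>t > 0\<close>. So everything reduces to comparing
  \<open>exp (u t)\<close> with the terms \<open>(u t)\<^sup>k / k!\<close> of its power series.

  Each term is at most the sum, which gives the moment bounds with the same \<open>\<epsilon>\<close>
  (\<open>moment_bound_of_young_conj_bound\<close>). Conversely, for \<open>0 < q < 1\<close> the series of \<open>exp (q u t)\<close>
  has the terms \<open>q\<^sup>k (u t)\<^sup>k / k!\<close>, and by the moment bounds their product with \<open>\<bar>g(x)\<bar>\<close> is at
  most \<open>C exp (\<phi>(t)) q\<^sup>k\<close>. Summing this geometric series costs the factor \<open>1 / (1 - q)\<close> and the
  passage from \<open>u\<close> to \<open>q u\<close>
  (\<open>young_conj_bound_of_moment_bounds\<close>). The loss is harmless because the bounds are required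
  for every \<open>\<epsilon>\<close>: take \<open>q = (\<sigma> + \<epsilon>/2) / (\<sigma> + \<epsilon>)\<close>.\<close>

lemma bdd_above_young_conj:
  fixes g :: "real \<Rightarrow> real"
  assumes nonneg: "\<And>y. y > 0 \<Longrightarrow> g y \<ge> 0"
    and superlinear: "filterlim (\<lambda>y. g y / y) at_top at_top"
    and "x \<ge> 0"
  shows "bdd_above ((\<lambda>y. x * y - g y) ` {0<..})"
proof -
  from superlinear have "eventually (\<lambda>y. x \<le> g y / y) at_top"
    by (simp add: filterlim_at_top)
  then obtain T where T: "\<And>y. y \<ge> T \<Longrightarrow> x \<le> g y / y"
    by (auto simp: eventually_at_top_linorder)
  have "x * y - g y \<le> x * \<bar>T\<bar>" if "y > 0" for y
  proof (cases "y \<ge> T")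
    case True
    with T[of y] that have "x * y \<le> g y"
      by (simp add: field_simps)
    moreover have "x * \<bar>T\<bar> \<ge> 0"
      using \<open>x \<ge> 0\<close> by simp
    ultimately show ?thesis
      by linarith
  next
    case False
    then have "x * y \<le> x * \<bar>T\<bar>"
      using \<open>x \<ge> 0\<close> by (intro mult_left_mono) auto
    with nonneg[OF that] show ?thesis
      by linarith
  qed
  then show ?thesis
    by (auto intro!: bdd_aboveI2)
qed

lemma young_inequality:
  fixes g :: "real \<Rightarrow> real"
  assumes "\<And>y. y > 0 \<Longrightarrow> g y \<ge> 0"
    and "filterlim (\<lambda>y. g y / y) at_top at_top"
    and "x \<ge> 0" and "y > 0"
  shows "x * y - g y \<le> young_conj g x"
  unfolding young_conj_def
  using bdd_above_young_conj[OF assms(1-3)] \<open>y > 0\<close> by (intro cSUP_upper) auto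

lemma superlinear_comp_exp:
  fixes \<phi> :: "real \<Rightarrow> real"
  assumes "filterlim (\<lambda>y. \<phi> y / y) at_top at_top"
  shows "filterlim (\<lambda>y. \<phi> (exp y) / y) at_top at_top"
proof (rule filterlim_at_top_mono)
  have "filterlim (\<lambda>y. \<phi> (exp y) / exp y) at_top at_top"
    using assms exp_at_top by (rule filterlim_compose)
  then show lim: "filterlim (\<lambda>y. \<phi> (exp y) / exp y) at_top at_top" .
  have "eventually (\<lambda>y. 0 \<le> \<phi> (exp y) / exp y) at_top"
    using lim by (simp add: filterlim_at_top)
  then show "eventually (\<lambda>y. \<phi> (exp y) / exp y \<le> \<phi> (exp y) / y) at_top"
    using eventually_gt_at_top[of 0]
  proof eventually_elim
    case (elim y)
    have "y \<le> exp y"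
      using exp_ge_add_one_self[of y] by linarith
    with elim show ?case
      by (intro divide_left_mono) (auto simp: zero_le_divide_iff)
  qed
qed

text \<open>The Young inequality for the conjugate of \<open>\<phi> \<circ> exp\<close>, multiplicatively, at \<open>y = ln t\<close>.
  It is restricted to \<open>t > 1\<close> because the conjugate is a supremum over \<open>y > 0\<close>.\<close>

lemma power_le_exp_young_conj:
  fixes \<phi> :: "real \<Rightarrow> real"
  assumes "\<And>y. y > 0 \<Longrightarrow> \<phi> y \<ge> 0"
    and "filterlim (\<lambda>y. \<phi> y / y) at_top at_top"
    and "t > 1"
  shows "t ^ k * exp (- young_conj (\<lambda>y. \<phi> (exp y)) (real k)) \<le> exp (\<phi> t)"
proof -
  have "real k * ln t - \<phi> (exp (ln t)) \<le> young_conj (\<lambda>y. \<phi> (exp y)) (real k)"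
    using assms superlinear_comp_exp[OF assms(2)] by (intro young_inequality) auto
  moreover have "t ^ k = exp (real k * ln t)"
    using \<open>t > 1\<close> by (simp add: exp_of_nat_mult)
  ultimately show ?thesis
    using \<open>t > 1\<close> by (simp flip: exp_add)
qed

lemma power_over_fact_le_exp:
  fixes z :: real
  assumes "z \<ge> 0"
  shows "z ^ k / fact k \<le> exp z"
proof -
  have "(\<Sum>n\<in>{k}. z ^ n /\<^sub>R fact n) \<le> exp z"
    unfolding exp_def using assms by (intro sum_le_suminf summable_exp_generic) auto
  then show ?thesis
    by (simp add: field_simps)
qed

text \<open>Multiplying \<open>(u t)\<^sup>k / k! \<le> exp (u t)\<close> by \<open>exp (- \<phi>\<^sup>*(u)) \<le> exp (\<phi>(t) - u t)\<close> leaves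
  \<open>u\<^sup>k exp (- \<phi>\<^sup>*(u)) \<le> k! exp (\<phi>(t) - k ln t)\<close>, and \<open>t = exp y\<close> is arbitrary.\<close>

lemma moment_bound_of_young_conj_bound:
  fixes \<phi> :: "real \<Rightarrow> real"
  assumes "\<And>y. y > 0 \<Longrightarrow> \<phi> y \<ge> 0"
    and "filterlim (\<lambda>y. \<phi> y / y) at_top at_top"
    and "u \<ge> 0"
  shows "u ^ k * exp (- young_conj \<phi> u)
    \<le> fact k * exp (- young_conj (\<lambda>y. \<phi> (exp y)) (real k))"
proof (cases "u ^ k = 0")
  case True
  then show ?thesis
    by (simp only: mult_zero_left) simp
next
  case False
  with zero_le_power[OF \<open>u \<ge> 0\<close>, of k] have pos: "u ^ k > 0"
    by linarith
  have "real k * y - \<phi> (exp y) \<le> ln (fact k) - ln (u ^ k) + young_conj \<phi> u" for y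
  proof -
    have "(u * exp y) ^ k / fact k \<le> exp (u * exp y)"
      using \<open>u \<ge> 0\<close> by (intro power_over_fact_le_exp) simp
    then have "u ^ k * exp (real k * y) \<le> fact k * exp (u * exp y)"
      by (simp add: exp_of_nat_mult exp_of_nat2_mult power_mult_distrib field_simps)
    then have "ln (u ^ k * exp (real k * y)) \<le> ln (fact k * exp (u * exp y))"
      using pos by (subst ln_le_cancel_iff) auto
    then have "ln (u ^ k) + real k * y \<le> ln (fact k) + u * exp y"
      using pos by (simp only: ln_mult_pos exp_gt_zero fact_gt_zero ln_exp)
    moreover have "u * exp y - \<phi> (exp y) \<le> young_conj \<phi> u"
      using assms by (intro young_inequality) auto
    ultimately show ?thesis
      by linarith
  qed
  then have "young_conj (\<lambda>y. \<phi> (exp y)) (real k) \<le> ln (fact k) - ln (u ^ k) + young_conj \<phi> u"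
    unfolding young_conj_def[of "\<lambda>y. \<phi> (exp y)"] by (intro cSUP_least) auto
  then have "exp (ln (u ^ k) - young_conj \<phi> u)
      \<le> exp (ln (fact k) - young_conj (\<lambda>y. \<phi> (exp y)) (real k))"
    by simp
  then show ?thesis
    using pos by (simp add: exp_diff exp_minus field_simps)
qed

text \<open>Summing the moment bounds, weighted by \<open>(q t)\<^sup>k\<close>, against the exponential series gives
  \<open>a exp (q u t) \<le> C exp (\<phi>(t)) / (1 - q)\<close> for \<open>t > 1\<close>. The values \<open>t \<le> 1\<close>, which are visible to
  \<open>\<phi>\<^sup>*\<close> but not to the conjugate of \<open>\<phi> \<circ> exp\<close>, are dominated by \<open>t = 2\<close> at the cost of the
  factor \<open>exp (\<phi>(2))\<close>.\<close>

lemma young_conj_bound_of_moment_bounds: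
  fixes \<phi> :: "real \<Rightarrow> real"
  assumes nonneg: "\<And>y. y > 0 \<Longrightarrow> \<phi> y \<ge> 0"
    and superlinear: "filterlim (\<lambda>y. \<phi> y / y) at_top at_top"
    and "u \<ge> 0" "a \<ge> 0" "C \<ge> 0" "0 < q" "q < 1"
    and moments: "\<And>k. u ^ k * a \<le> C * fact k * exp (- young_conj (\<lambda>y. \<phi> (exp y)) (real k))"
  shows "a \<le> C * exp (\<phi> 2) / (1 - q) * exp (- young_conj \<phi> (q * u))"
proof (cases "a = 0")
  case True
  then show ?thesis
    using assms by simp
next
  case False
  with \<open>a \<ge> 0\<close> have "a > 0"
    by simp
  have large: "a * exp (q * u * t) \<le> C * exp (\<phi> t) / (1 - q)" if "t > 1" for t
  proof (rule sums_le)
    show "(\<lambda>k. a * ((q * u * t) ^ k /\<^sub>R fact k)) sums (a * exp (q * u * t))"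
      by (intro sums_mult exp_converges)
    show "(\<lambda>k. C * exp (\<phi> t) * q ^ k) sums (C * exp (\<phi> t) / (1 - q))"
      using sums_mult[OF geometric_sums[of q], of "C * exp (\<phi> t)"] \<open>0 < q\<close> \<open>q < 1\<close> by simp
    show "a * ((q * u * t) ^ k /\<^sub>R fact k) \<le> C * exp (\<phi> t) * q ^ k" for k
    proof -
      have "a * ((q * u * t) ^ k /\<^sub>R fact k) = (q * t) ^ k * (u ^ k * a / fact k)"
        by (simp add: field_simps)
      also have "\<dots> \<le> (q * t) ^ k * (C * exp (- young_conj (\<lambda>y. \<phi> (exp y)) (real k)))"
        using moments[of k] \<open>0 < q\<close> that by (intro mult_left_mono) (auto simp: field_simps)
      also have "\<dots> = C * q ^ k * (t ^ k * exp (- young_conj (\<lambda>y. \<phi> (exp y)) (real k)))"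
        by (simp add: power_mult_distrib)
      also have "\<dots> \<le> C * q ^ k * exp (\<phi> t)"
        using power_le_exp_young_conj[OF nonneg superlinear that, of k] \<open>0 < q\<close> \<open>C \<ge> 0\<close>
        by (intro mult_left_mono) auto
      finally show ?thesis
        by (simp add: mult_ac)
    qed
  qed
  have "C > 0"
    using large[of 2] \<open>a > 0\<close> \<open>q < 1\<close> \<open>C \<ge> 0\<close> by (cases "C = 0") (auto simp: mult_le_0_iff)
  define L where "L = ln (C / ((1 - q) * a))"
  have expL: "exp L = C / ((1 - q) * a)"
    using \<open>C > 0\<close> \<open>a > 0\<close> \<open>q < 1\<close> by (simp add: L_def)
  have L: "q * u * t - \<phi> t \<le> L" if "t > 1" for t
  proof -
    have "exp (q * u * t - \<phi> t) \<le> exp L"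
      using large[OF that] \<open>a > 0\<close> \<open>q < 1\<close> by (simp add: expL exp_diff field_simps)
    then show ?thesis
      by simp
  qed
  have "q * u * t - \<phi> t \<le> L + \<phi> 2" if "t > 0" for t
  proof (cases "t > 1")
    case True
    then show ?thesis
      using L[of t] nonneg[of 2] by simp
  next
    case False
    then have "q * u * t \<le> q * u * 2"
      using \<open>0 < q\<close> \<open>u \<ge> 0\<close> by (intro mult_left_mono) auto
    then show ?thesis
      using L[of 2] nonneg[OF that] by simp
  qed
  then have "young_conj \<phi> (q * u) \<le> L + \<phi> 2"
    unfolding young_conj_def by (intro cSUP_least) auto
  then have "exp (young_conj \<phi> (q * u)) \<le> exp (L + \<phi> 2)"
    by simp
  then show ?thesis
    using \<open>a > 0\<close> \<open>q < 1\<close> by (simp add: exp_add expL exp_minus field_simps)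
qed

lemma G_norm_finite_iff:
  fixes f :: "real \<Rightarrow> complex"
  assumes "\<sigma> + \<epsilon> > 0"
  shows "G_norm \<sigma> \<Psi> \<epsilon> m f \<noteq> \<infinity> \<longleftrightarrow>
    (\<forall>n\<le>m. \<exists>C>0. \<forall>x k. (\<bar>x\<bar> / (\<sigma> + \<epsilon>)) ^ k * cmod (nderiv n f x)
       \<le> C * fact k * exp (- \<Psi> (real k)))"
proof -
  define R where "R n x k = cmod (of_real x ^ k * nderiv n f x) /
     (fact k * (\<sigma> + \<epsilon>) ^ k * exp (- \<Psi> (real k)))" for n x k
  have R_le_iff: "R n x k \<le> C \<longleftrightarrow>
      (\<bar>x\<bar> / (\<sigma> + \<epsilon>)) ^ k * cmod (nderiv n f x) \<le> C * fact k * exp (- \<Psi> (real k))" for n x k C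
    using assms by (simp add: R_def norm_mult norm_power power_divide field_simps)
  have sup_iff: "(SUP (x, k)\<in>UNIV. ereal (R n x k)) < \<infinity> \<longleftrightarrow> (\<exists>C>0. \<forall>x k. R n x k \<le> C)"
    (is "?S < \<infinity> \<longleftrightarrow> _") for n
  proof
    assume "?S < \<infinity>"
    moreover have upper: "ereal (R n x k) \<le> ?S" for x k
      by (rule SUP_upper2[of "(x, k)"]) auto
    ultimately obtain c where "?S = ereal c"
      using upper[of 0 0] by (cases ?S) auto
    with upper have "R n x k \<le> \<bar>c\<bar> + 1" for x k
      by (metis abs_ge_self add_increasing2 ereal_less_eq(3) order_trans zero_le_one)
    then show "\<exists>C>0. \<forall>x k. R n x k \<le> C"
      by (intro exI[of _ "\<bar>c\<bar> + 1"]) auto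
  next
    assume "\<exists>C>0. \<forall>x k. R n x k \<le> C"
    then obtain C where "\<And>x k. R n x k \<le> C"
      by blast
    then have "?S \<le> ereal C"
      by (intro SUP_least) auto
    then show "?S < \<infinity>"
      using le_less_trans by fastforce
  qed
  have "G_norm \<sigma> \<Psi> \<epsilon> m f = (MAX n\<in>{0..m}. SUP (x, k)\<in>UNIV. ereal (R n x k))"
    by (simp add: G_norm_def R_def)
  then have "G_norm \<sigma> \<Psi> \<epsilon> m f < \<infinity> \<longleftrightarrow> (\<forall>n\<in>{0..m}. (SUP (x, k)\<in>UNIV. ereal (R n x k)) < \<infinity>)"
    using Max_less_iff[of "(\<lambda>n. SUP (x, k)\<in>UNIV. ereal (R n x k)) ` {0..m}" \<infinity>]
    by (simp del: ereal_infty_less)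
  then show ?thesis
    unfolding sup_iff R_le_iff by (simp add: atLeast0AtMost Ball_def del: power_divide)
qed

theorem theorem4:
  fixes \<sigma> :: real and \<phi> \<psi> :: "real \<Rightarrow> real"
  assumes "\<sigma> > 0"
    and "\<And>x. x \<ge> 0 \<Longrightarrow> \<phi> x \<ge> 0"
    and "mono_on {0..} \<phi>"
    and "continuous_on {0..} \<phi>"
    and "filterlim (\<lambda>x. \<phi> x / x) at_top at_top"
    and "\<And>h. h > 1 \<Longrightarrow> \<exists>K>0. \<forall>x\<ge>0. 2 * \<phi> x \<le> \<phi> (h * x) + K"
    and "\<And>x. \<psi> x = \<phi> (exp x)"
    and "convex_on {0..} \<psi>"
    and "convex_on {0..} \<phi>"
  shows "G_space \<sigma> (young_conj \<psi>) =
    {f \<in> Cinf. \<forall>\<epsilon>>0. \<forall>n. \<exists>C>0. \<forall>x.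
       cmod (nderiv n f x) \<le> C * exp (- young_conj \<phi> (\<bar>x\<bar> / (\<sigma> + \<epsilon>)))}"
proof -
  define moment_bounded where "moment_bounded f \<epsilon> n \<longleftrightarrow>
      (\<exists>C>0. \<forall>x k. (\<bar>x\<bar> / (\<sigma> + \<epsilon>)) ^ k * cmod (nderiv n f x)
        \<le> C * fact k * exp (- young_conj \<psi> (real k)))" for f \<epsilon> n
  define conj_bounded where "conj_bounded f \<epsilon> n \<longleftrightarrow>
      (\<exists>C>0. \<forall>x. cmod (nderiv n f x) \<le> C * exp (- young_conj \<phi> (\<bar>x\<bar> / (\<sigma> + \<epsilon>))))" for f \<epsilon> n
  have \<psi>: "\<psi> = (\<lambda>y. \<phi> (exp y))"
    using assms(7) by auto
  have nonneg: "\<phi> y \<ge> 0" if "y > 0" for y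
    using assms(2) that by simp
  note superlinear = \<open>filterlim (\<lambda>x. \<phi> x / x) at_top at_top\<close>
  have mem_iff: "f \<in> G_space \<sigma> (young_conj \<psi>) \<longleftrightarrow> f \<in> Cinf \<and> (\<forall>\<epsilon>>0. \<forall>n. moment_bounded f \<epsilon> n)" for f
  proof -
    have "G_norm \<sigma> (young_conj \<psi>) \<epsilon> m f \<noteq> \<infinity> \<longleftrightarrow> (\<forall>n\<le>m. moment_bounded f \<epsilon> n)" if "\<epsilon> > 0" for \<epsilon> m
      using G_norm_finite_iff[of \<sigma> \<epsilon>] \<open>\<sigma> > 0\<close> that by (simp add: moment_bounded_def)
    then have "f \<in> G_space \<sigma> (young_conj \<psi>) \<longleftrightarrow>
        (\<forall>\<epsilon>>0. \<forall>m. f \<in> Cm m \<and> (\<forall>n\<le>m. moment_bounded f \<epsilon> n))"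
      by (auto simp: G_space_def G_space_eps_def)
    then show ?thesis
      unfolding Cinf_def by (metis INT_iff UNIV_I le_refl zero_less_one)
  qed
  have moment_of_conj: "moment_bounded f \<epsilon> n" if "\<epsilon> > 0" "conj_bounded f \<epsilon> n" for f \<epsilon> n
  proof -
    from that(2) obtain C where "C > 0"
      and C: "\<And>x. cmod (nderiv n f x) \<le> C * exp (- young_conj \<phi> (\<bar>x\<bar> / (\<sigma> + \<epsilon>)))"
      unfolding conj_bounded_def by blast
    have "(\<bar>x\<bar> / (\<sigma> + \<epsilon>)) ^ k * cmod (nderiv n f x)
        \<le> C * fact k * exp (- young_conj \<psi> (real k))" for x k
    proof -
      let ?u = "\<bar>x\<bar> / (\<sigma> + \<epsilon>)"
      have "?u \<ge> 0"
        using \<open>\<sigma> > 0\<close> \<open>\<epsilon> > 0\<close> by simp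
      then have "?u ^ k * cmod (nderiv n f x) \<le> ?u ^ k * (C * exp (- young_conj \<phi> ?u))"
        by (intro mult_left_mono C) simp
      also have "\<dots> = C * (?u ^ k * exp (- young_conj \<phi> ?u))"
        by (simp only: mult_ac)
      also have "\<dots> \<le> C * (fact k * exp (- young_conj \<psi> (real k)))"
        unfolding \<psi> using moment_bound_of_young_conj_bound[OF nonneg superlinear \<open>?u \<ge> 0\<close>] \<open>C > 0\<close>
        by (intro mult_left_mono) auto
      finally show ?thesis
        by (simp only: mult_ac)
    qed
    with \<open>C > 0\<close> show ?thesis
      unfolding moment_bounded_def by blast
  qed
  have conj_of_moment: "conj_bounded f \<epsilon> n" if "\<epsilon> > 0" "moment_bounded f (\<epsilon> / 2) n" for f \<epsilon> n
  proof -
    from that(2) obtain C where "C > 0"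
      and C: "\<And>x k. (\<bar>x\<bar> / (\<sigma> + \<epsilon> / 2)) ^ k * cmod (nderiv n f x)
        \<le> C * fact k * exp (- young_conj \<psi> (real k))"
      unfolding moment_bounded_def by blast
    define q where "q = (\<sigma> + \<epsilon> / 2) / (\<sigma> + \<epsilon>)"
    have q: "0 < q" "q < 1"
      using \<open>\<sigma> > 0\<close> \<open>\<epsilon> > 0\<close> by (auto simp: q_def)
    have "cmod (nderiv n f x)
        \<le> C * exp (\<phi> 2) / (1 - q) * exp (- young_conj \<phi> (\<bar>x\<bar> / (\<sigma> + \<epsilon>)))" for x
    proof -
      have "q * (\<bar>x\<bar> / (\<sigma> + \<epsilon> / 2)) = \<bar>x\<bar> / (\<sigma> + \<epsilon>)"
        using \<open>\<sigma> > 0\<close> \<open>\<epsilon> > 0\<close> by (simp add: q_def)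
      moreover have "cmod (nderiv n f x)
          \<le> C * exp (\<phi> 2) / (1 - q) * exp (- young_conj \<phi> (q * (\<bar>x\<bar> / (\<sigma> + \<epsilon> / 2))))"
        using \<open>\<sigma> > 0\<close> \<open>\<epsilon> > 0\<close> \<open>C > 0\<close> q C[unfolded \<psi>]
        by (intro young_conj_bound_of_moment_bounds[OF nonneg superlinear]) auto
      ultimately show ?thesis
        by simp
    qed
    moreover have "C * exp (\<phi> 2) / (1 - q) > 0"
      using \<open>C > 0\<close> q by simp
    ultimately show ?thesis
      unfolding conj_bounded_def by blast
  qed
  have "(\<forall>\<epsilon>>0. \<forall>n. moment_bounded f \<epsilon> n) \<longleftrightarrow> (\<forall>\<epsilon>>0. \<forall>n. conj_bounded f \<epsilon> n)" for f
    using moment_of_conj conj_of_moment half_gt_zero by blast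
  then show ?thesis
    by (auto simp: mem_iff conj_bounded_def)
qed

end
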